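(* Let $\psi:(0,\infty)\to(0,\infty)$ be a function such that $\lim_{u\to\infty}\psi(u)=\infty$. Then there exist a two-dimensional real normed space $X$ and a well-distributed set $S\subset X$ such that $$|\Delta_{X,N}(S)|=o(N\psi(N))\quad (N\to\infty),$$ but $\mathrm{Ext}(BX)$ is a perfect set (and therefore is uncountable).
   Context: $X$ denotes $\mathbb{R}^2$ equipped with a norm $\|\cdot\|_X$, and $BX=\{x:\|x\|_X\le 1\}$. A set $S\subset X$ is well-distributed if there is a constant $K$ such that for every $x\in X$ there is $y\in S$ with $\|x-y\|_X\le K$. For a positive integer $N$ and $A\subset X$, $\Delta_{X,N}(A)$ is the set of all numbers $\|a-a'\|_X$ with $a,a'\in A$ and $\|a-a'\|_X\le N$; $|\cdot|$ denotes cardinality, and $N$ runs over positive integers. For a convex set $A$, $\mathrm{Ext}(A)$ is the set of extremal points of $A$: $x\in\mathrm{Ext}(A)$ iff $x\in A$ and for any segment $[y,z]$, $x\in[y,z]\subset A$ implies $x=y$ or $x=z$. A perfect set is a nonempty closed set without isolated points. *)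

theory Defs
  imports "HOL-Analysis.Analysis" "HOL-Library.Landau_Symbols"
begin

text \<open>
  A two-dimensional real normed space is given by a norm \<open>\<nu>\<close> on \<open>\<real>\<^sup>2\<close>. The norm is an
  explicit function, since the statement quantifies over it; the type class norm of
  \<^typ>\<open>real^2\<close> plays no role.
\<close>

definition is_norm :: "(real^2 \<Rightarrow> real) \<Rightarrow> bool" where
  "is_norm \<nu> \<longleftrightarrow>
     (\<forall>x. 0 \<le> \<nu> x) \<and>
     (\<forall>x. \<nu> x = 0 \<longleftrightarrow> x = 0) \<and>
     (\<forall>c x. \<nu> (c *\<^sub>R x) = \<bar>c\<bar> * \<nu> x) \<and>
     (\<forall>x y. \<nu> (x + y) \<le> \<nu> x + \<nu> y)"

definition unit_ball :: "(real^2 \<Rightarrow> real) \<Rightarrow> (real^2) set" where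
  "unit_ball \<nu> = {x. \<nu> x \<le> 1}"

definition well_distributed :: "(real^2 \<Rightarrow> real) \<Rightarrow> (real^2) set \<Rightarrow> bool" where
  "well_distributed \<nu> S \<longleftrightarrow> (\<exists>K. \<forall>x. \<exists>y\<in>S. \<nu> (x - y) \<le> K)"

definition dist_set :: "(real^2 \<Rightarrow> real) \<Rightarrow> nat \<Rightarrow> (real^2) set \<Rightarrow> real set" where
  "dist_set \<nu> N A = {\<nu> (a - a') | a a'. a \<in> A \<and> a' \<in> A \<and> \<nu> (a - a') \<le> real N}"

definition Ext :: "(real^2) set \<Rightarrow> (real^2) set" where
  "Ext A = {x. x extreme_point_of A}"

definition norm_topology :: "(real^2 \<Rightarrow> real) \<Rightarrow> (real^2) topology" where
  "norm_topology \<nu> = Metric_space.mtopology UNIV (\<lambda>x y. \<nu> (x - y))"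

text \<open>A nonempty closed set without isolated points: each of its points is a limit point of it.\<close>

definition perfect_in :: "'a topology \<Rightarrow> 'a set \<Rightarrow> bool" where
  "perfect_in T P \<longleftrightarrow> P \<noteq> {} \<and> closedin T P \<and> P \<subseteq> T derived_set_of P"

lemma is_norm_minus_commute:
  assumes "is_norm \<nu>"
  shows "\<nu> (x - y) = \<nu> (y - x)"
proof -
  have "\<nu> ((-1) *\<^sub>R (y - x)) = \<bar>-1\<bar> * \<nu> (y - x)"
    using assms unfolding is_norm_def by blast
  then show ?thesis by simp
qed

lemma Metric_space_is_norm:
  assumes "is_norm \<nu>"
  shows "Metric_space UNIV (\<lambda>x y. \<nu> (x - y))"
proof
  fix x y z :: "real^2"
  show "0 \<le> \<nu> (x - y)" using assms by (simp add: is_norm_def)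
  show "\<nu> (x - y) = \<nu> (y - x)" by (rule is_norm_minus_commute[OF assms])
  show "\<nu> (x - y) = 0 \<longleftrightarrow> x = y" using assms by (simp add: is_norm_def)
  have "\<nu> ((x - y) + (y - z)) \<le> \<nu> (x - y) + \<nu> (y - z)"
    using assms unfolding is_norm_def by blast
  then show "\<nu> (x - z) \<le> \<nu> (x - y) + \<nu> (y - z)" by simp
qed

lemma convex_unit_ball:
  assumes "is_norm \<nu>"
  shows "convex (unit_ball \<nu>)"
proof (rule convexI)
  fix x y and u v :: real
  assume *: "x \<in> unit_ball \<nu>" "y \<in> unit_ball \<nu>" "0 \<le> u" "0 \<le> v" "u + v = 1"
  have "\<nu> (u *\<^sub>R x + v *\<^sub>R y) \<le> \<nu> (u *\<^sub>R x) + \<nu> (v *\<^sub>R y)"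
    using assms unfolding is_norm_def by blast
  also have "\<dots> = u * \<nu> x + v * \<nu> y"
    using assms * by (simp add: is_norm_def)
  also have "\<dots> \<le> u * 1 + v * 1"
    using * by (intro add_mono mult_left_mono) (auto simp: unit_ball_def)
  finally show "u *\<^sub>R x + v *\<^sub>R y \<in> unit_ball \<nu>"
    using * by (simp add: unit_ball_def)
qed

text \<open>For convex sets, the definition of extremal points in terms of closed segments
  agrees with the library's extreme points.\<close>

lemma Ext_iff_closed_segment:
  assumes "convex A"
  shows "x \<in> Ext A \<longleftrightarrow>
    x \<in> A \<and> (\<forall>y z. x \<in> closed_segment y z \<and> closed_segment y z \<subseteq> A \<longrightarrow> x = y \<or> x = z)"
  using assms
  unfolding Ext_def extreme_point_of_def open_segment_def mem_Collect_eq convex_contains_segment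
  by (auto; metis ends_in_segment subsetD)

end

theory Submission
  imports Defs
begin

text \<open>
  Take \<open>S = \<int>\<^sup>2\<close> and start from the square \<open>max \<bar>x\<^sub>1\<bar> \<bar>x\<^sub>2\<bar> \<le> 1\<close>. Run through all other
  rational directions \<open>g\<close> and, for each of them, cut the corner of the current polygon at which \<open>g\<close> is
  maximal by a side \<open>\<lambda> (g \<bullet> x) = 1\<close>. For integer vectors \<open>g\<close>, the lattice points whose norm is governed
  by this side have norms in \<open>\<lambda>\<int>\<close>, and \<open>\<lambda>\<close> is bounded below in terms of \<open>g\<close> alone, however small the
  cut is. So the \<open>k\<close>-th cut may be so small that it changes the norm of a lattice point of norm
  at most \<open>M k\<close> only if this point lies on a ray through a corner; each such ray contributes only \<open>O(N)\<close>
  distances up to \<open>N\<close>. Hence there are at most \<open>C k * N\<close> distances up to \<open>N \<le> M k\<close>, where the sequences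
  \<open>C\<close> and \<open>M\<close> can be fixed, according to \<open>\<psi>\<close>, before any cut is made.

  In the limit every rational direction has a nondegenerate face. An isolated extreme point would be
  the whole face of an open set of directions, so there is none.
\<close>

subsection \<open>Extreme points of the unit ball of a planar norm\<close>

lemma inner_real2: "(x::real^2) \<bullet> y = x$1 * y$1 + x$2 * y$2"
  by (simp add: inner_vec_def sum_2)

lemma eq_real2_iff: "(x::real^2) = y \<longleftrightarrow> x$1 = y$1 \<and> x$2 = y$2"
  by (simp add: vec_eq_iff forall_2)

section \<open>Comparison of a planar norm with the Euclidean norm\<close>

lemma is_normD:
  assumes "is_norm \<nu>"
  shows "0 \<le> \<nu> x" "\<nu> x = 0 \<longleftrightarrow> x = 0" "\<nu> (c *\<^sub>R x) = \<bar>c\<bar> * \<nu> x" "\<nu> (x + y) \<le> \<nu> x + \<nu> y"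
  using assms by (auto simp: is_norm_def)

lemma is_norm_uminus: "is_norm \<nu> \<Longrightarrow> \<nu> (- x) = \<nu> x"
  using is_normD(3)[of \<nu> "-1" x] by simp

lemma is_norm_upper:
  assumes "is_norm \<nu>"
  obtains C where "C > 0" "\<And>x. \<nu> x \<le> C * norm x"
proof -
  define C where "C = \<nu> (axis 1 1) + \<nu> (axis 2 1) + 1"
  have C: "\<nu> x \<le> C * norm x" for x
  proof -
    have "x = x$1 *\<^sub>R axis 1 1 + x$2 *\<^sub>R axis 2 1"
      by (simp add: eq_real2_iff axis_def)
    then have "\<nu> x \<le> \<nu> (x$1 *\<^sub>R axis 1 1) + \<nu> (x$2 *\<^sub>R axis 2 1)"
      by (metis is_normD(4)[OF assms])
    also have "\<dots> = \<bar>x$1\<bar> * \<nu> (axis 1 1) + \<bar>x$2\<bar> * \<nu> (axis 2 1)"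
      by (simp add: is_normD(3)[OF assms])
    also have "\<dots> \<le> norm x * \<nu> (axis 1 1) + norm x * \<nu> (axis 2 1)"
      by (intro add_mono mult_right_mono component_le_norm_cart is_normD(1)[OF assms])
    finally show ?thesis
      by (simp add: C_def algebra_simps) (smt (verit) norm_ge_zero)
  qed
  have "C > 0"
    using is_normD(1)[OF assms, of "axis 1 1"] is_normD(1)[OF assms, of "axis 2 1"]
    by (simp add: C_def)
  with C that show ?thesis by blast
qed

lemma is_norm_diff_le: "is_norm \<nu> \<Longrightarrow> \<bar>\<nu> x - \<nu> y\<bar> \<le> \<nu> (x - y)"
  using is_normD(4)[of \<nu> "x - y" y] is_normD(4)[of \<nu> "y - x" x] is_norm_minus_commute[of \<nu> x y]
  by simp

lemma continuous_on_is_norm: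
  assumes "is_norm \<nu>"
  shows "continuous_on A \<nu>"
proof -
  obtain C where C: "C > 0" "\<And>x. \<nu> x \<le> C * norm x"
    using is_norm_upper[OF assms] by blast
  have "dist (\<nu> x) (\<nu> y) \<le> C * dist x y" for x y
    using is_norm_diff_le[OF assms, of x y] C(2)[of "x - y"] by (simp add: dist_norm)
  then show ?thesis
    using C(1) by (intro lipschitz_on_continuous_on[of C] lipschitz_onI) auto
qed

lemma is_norm_lower:
  assumes "is_norm \<nu>"
  obtains c where "c > 0" "\<And>x. c * norm x \<le> \<nu> x"
proof -
  have "sphere 0 1 \<noteq> ({} :: (real^2) set)" by simp
  then obtain u :: "real^2" where u: "u \<in> sphere 0 1" "\<And>x. x \<in> sphere 0 1 \<Longrightarrow> \<nu> u \<le> \<nu> x"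
    using continuous_attains_inf[OF compact_sphere _ continuous_on_is_norm[OF assms]] by blast
  have "\<nu> u > 0"
    using u(1) is_normD(1,2)[OF assms, of u] by (metis mem_sphere_0 norm_zero zero_neq_one less_eq_real_def)
  moreover have "\<nu> u * norm x \<le> \<nu> x" for x
  proof (cases "x = 0")
    case False
    have "\<nu> u \<le> \<nu> ((1 / norm x) *\<^sub>R x)"
      using False by (intro u(2)) simp
    then show ?thesis
      using False by (simp add: is_normD(3)[OF assms] field_simps)
  qed (use assms in \<open>simp add: is_norm_def\<close>)
  ultimately show ?thesis using that by blast
qed

text \<open>The two comparisons with the Euclidean norm nest the balls of both metrics in each
  other, so closed sets and limit points may be taken in the Euclidean sense.\<close>

lemma norm_topology_euclidean:
  assumes "is_norm \<nu>"
  shows "norm_topology \<nu> = euclidean"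
proof -
  interpret Metric_space UNIV "\<lambda>x y. \<nu> (x - y)"
    by (rule Metric_space_is_norm[OF assms])
  obtain C where C: "C > 0" "\<And>x. \<nu> x \<le> C * norm x"
    using is_norm_upper[OF assms] by blast
  obtain c where c: "c > 0" "\<And>x. c * norm x \<le> \<nu> x"
    using is_norm_lower[OF assms] by blast
  have 1: "ball x (r / C) \<subseteq> mball x r" if "r > 0" for x r
  proof
    fix y assume "y \<in> ball x (r / C)"
    then have "C * norm (x - y) < r"
      using C(1) by (simp add: dist_norm field_simps)
    then show "y \<in> mball x r"
      using C(2)[of "x - y"] by simp
  qed
  have 2: "mball x (c * r) \<subseteq> ball x r" for x r
  proof
    fix y assume "y \<in> mball x (c * r)"
    then have "c * norm (x - y) < c * r"
      using c(2)[of "x - y"] by simp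
    then show "y \<in> ball x r"
      using c(1) by (simp add: dist_norm)
  qed
  have "(\<exists>r>0. mball x r \<subseteq> U) \<longleftrightarrow> (\<exists>r>0. ball x r \<subseteq> U)" for x U
  proof
    assume "\<exists>r>0. mball x r \<subseteq> U"
    then obtain r where "r > 0" "mball x r \<subseteq> U" by blast
    then show "\<exists>r>0. ball x r \<subseteq> U"
      using 1[of r x] C(1) by (intro exI[of _ "r / C"]) auto
  next
    assume "\<exists>r>0. ball x r \<subseteq> U"
    then obtain r where "r > 0" "ball x r \<subseteq> U" by blast
    then show "\<exists>r>0. mball x r \<subseteq> U"
      using 2[of x r] c(1) by (intro exI[of _ "c * r"]) auto
  qed
  then have "openin mtopology U \<longleftrightarrow> open U" for U
    by (simp add: openin_mtopology open_contains_ball Ball_def)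
  then show ?thesis
    by (simp add: norm_topology_def topology_eq)
qed

lemma compact_unit_ball:
  assumes "is_norm \<nu>"
  shows "compact (unit_ball \<nu>)"
proof -
  obtain c where c: "c > 0" "\<And>x. c * norm x \<le> \<nu> x"
    using is_norm_lower[OF assms] by blast
  have "norm x \<le> 1 / c" if "x \<in> unit_ball \<nu>" for x
    using that c(1) c(2)[of x] by (simp add: unit_ball_def field_simps)
  then have "bounded (unit_ball \<nu>)"
    by (auto simp: bounded_iff)
  moreover have "closed (unit_ball \<nu>)"
    unfolding unit_ball_def
    by (intro closed_Collect_le continuous_on_is_norm[OF assms] continuous_on_const)
  ultimately show ?thesis
    by (simp add: compact_eq_bounded_closed)
qed

section \<open>Extreme points and supporting functionals\<close>

text \<open>A point of norm below 1 has room \<open>1 - \<nu> p\<close> in every direction, so it is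
  the midpoint of a segment inside the ball.\<close>

lemma Ext_unit_ball_norm_eq_1:
  assumes "is_norm \<nu>" "p \<in> Ext (unit_ball \<nu>)"
  shows "\<nu> p = 1"
proof (rule ccontr)
  assume "\<nu> p \<noteq> 1"
  moreover have ext: "p extreme_point_of unit_ball \<nu>"
    using assms(2) by (simp add: Ext_def)
  ultimately have lt: "\<nu> p < 1"
    by (simp add: extreme_point_of_def unit_ball_def)
  define e :: "real^2" where "e = axis 1 1"
  have e: "\<nu> e > 0"
    using is_normD(1,2)[OF assms(1), of e] by (simp add: e_def less_le)
  define u where "u = ((1 - \<nu> p) / \<nu> e) *\<^sub>R e"
  have u: "\<nu> u = 1 - \<nu> p"
    using e lt by (simp add: u_def is_normD(3)[OF assms(1)])
  then have "u \<noteq> 0"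
    using lt is_normD(2)[OF assms(1), of u] by auto
  then have "p - u \<noteq> p + u"
    by (simp add: eq_real2_iff)
  moreover have "p = midpoint (p - u) (p + u)"
    by (simp add: midpoint_def eq_real2_iff)
  ultimately have "p \<in> open_segment (p - u) (p + u)"
    using midpoint_in_open_segment[of "p - u" "p + u"] by simp
  moreover have "p - u \<in> unit_ball \<nu>" "p + u \<in> unit_ball \<nu>"
    using is_normD(4)[OF assms(1), of p u] is_normD(4)[OF assms(1), of p "-u"] u
    by (auto simp: unit_ball_def is_norm_uminus[OF assms(1)])
  ultimately show False
    using ext by (auto simp: extreme_point_of_def)
qed

lemma is_norm_supporting_functional:
  assumes "is_norm \<nu>" "\<nu> x = 1"
  obtains w where "w \<bullet> x > 0" "\<And>y. w \<bullet> y \<le> \<nu> y * (w \<bullet> x)"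
proof -
  have "convex {y. \<nu> y < 1}"
  proof (rule convexI)
    fix y z and u v :: real
    assume *: "y \<in> {y. \<nu> y < 1}" "z \<in> {y. \<nu> y < 1}" "0 \<le> u" "0 \<le> v" "u + v = 1"
    have "\<nu> (u *\<^sub>R y + v *\<^sub>R z) \<le> u * \<nu> y + v * \<nu> z"
      using is_normD(4)[OF assms(1), of "u *\<^sub>R y" "v *\<^sub>R z"] * by (simp add: is_normD(3)[OF assms(1)])
    also have "\<dots> < 1"
      using * by (intro convex_bound_lt) auto
    finally show "u *\<^sub>R y + v *\<^sub>R z \<in> {y. \<nu> y < 1}" by simp
  qed
  moreover have "0 \<in> {y. \<nu> y < 1}"
    using is_normD(2)[OF assms(1), of 0] by simp
  moreover have "{y. \<nu> y < 1} \<inter> {x} = {}"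
    using assms(2) by auto
  ultimately obtain w b where w: "w \<noteq> 0" "\<And>y. \<nu> y < 1 \<Longrightarrow> w \<bullet> y \<le> b" "b \<le> w \<bullet> x"
    using separating_hyperplane_sets[of "{y. \<nu> y < 1}" "{x}"] by auto
  \<comment> \<open>The separation only controls the open ball. Rescaling \<open>y\<close> by
    \<open>1 / t\<close> with \<open>t > \<nu> y\<close> and letting \<open>t\<close> decrease to
    \<open>\<nu> y\<close> gives the homogeneous bound, also for \<open>\<nu> y = 0\<close>.\<close>
  have le: "w \<bullet> y \<le> \<nu> y * (w \<bullet> x)" for y
  proof (rule tendsto_lowerbound)
    show "((\<lambda>t. t * (w \<bullet> x)) \<longlongrightarrow> \<nu> y * (w \<bullet> x)) (at_right (\<nu> y))"
      by (intro tendsto_intros)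
    show "\<forall>\<^sub>F t in at_right (\<nu> y). w \<bullet> y \<le> t * (w \<bullet> x)"
    proof (rule eventually_at_right_less[THEN eventually_mono])
      fix t assume t: "\<nu> y < t"
      then have "t > 0"
        using is_normD(1)[OF assms(1), of y] by linarith
      then have "\<nu> ((1 / t) *\<^sub>R y) < 1"
        using t by (simp add: is_normD(3)[OF assms(1)])
      from order_trans[OF w(2)[OF this] w(3)] show "w \<bullet> y \<le> t * (w \<bullet> x)"
        using \<open>t > 0\<close> by (simp add: field_simps)
    qed
  qed simp
  have "w \<bullet> w \<le> \<nu> w * (w \<bullet> x)" by (rule le)
  moreover have "w \<bullet> w > 0" using w(1) by simp
  ultimately have "w \<bullet> x > 0"
    using is_normD(1)[OF assms(1), of w] by (smt (verit) mult_nonneg_nonpos)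
  with le that show ?thesis by blast
qed

text \<open>This is special to the plane: in \<open>\<real>\<^sup>3\<close> the extreme points of a unit ball
  need not form a closed set.\<close>

lemma closed_Ext_unit_ball:
  assumes "is_norm \<nu>"
  shows "closed (Ext (unit_ball \<nu>))"
  unfolding closed_sequential_limits
proof safe
  fix f x assume f: "\<forall>n::nat. f n \<in> Ext (unit_ball \<nu>)" and lim: "f \<longlonglongrightarrow> x"
  have f1: "\<nu> (f n) = 1" for n
    using Ext_unit_ball_norm_eq_1[OF assms] f by blast
  have "(\<lambda>n. \<nu> (f n)) \<longlonglongrightarrow> \<nu> x"
    using continuous_on_tendsto_compose[OF continuous_on_is_norm[OF assms, of UNIV] lim] by simp
  then have x1: "\<nu> x = 1"
    by (simp add: f1 LIMSEQ_const_iff)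
  show "x \<in> Ext (unit_ball \<nu>)"
  proof (rule ccontr)
    assume "x \<notin> Ext (unit_ball \<nu>)"
    then obtain y z where yz: "\<nu> y \<le> 1" "\<nu> z \<le> 1" "x \<in> open_segment y z"
      using x1 by (auto simp: Ext_def extreme_point_of_def unit_ball_def)
    then obtain t where t: "0 < t" "t < 1" "x = (1 - t) *\<^sub>R y + t *\<^sub>R z" and "y \<noteq> z"
      by (auto simp: in_segment)
    obtain w where w: "w \<bullet> x > 0" "\<And>y. w \<bullet> y \<le> \<nu> y * (w \<bullet> x)"
      using is_norm_supporting_functional[OF assms x1] by blast
    define c where "c = w \<bullet> x"
    have c0: "c > 0" using w(1) by (simp add: c_def)
    have "w \<bullet> p \<le> c" if "\<nu> p \<le> 1" for p
      using order_trans[OF w(2)[of p] mult_right_mono[OF that]] c0 by (simp add: c_def)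
    then have le: "w \<bullet> y \<le> c" "w \<bullet> z \<le> c"
      using yz by auto
    \<comment> \<open>A weighted average of two nonnegative defects vanishes, so the supporting line
      at \<open>x\<close> contains both endpoints.\<close>
    have "(1 - t) * (c - w \<bullet> y) + t * (c - w \<bullet> z) = 0"
      unfolding c_def t(3) by (simp add: inner_add_right algebra_simps)
    moreover have "(1 - t) * (c - w \<bullet> y) \<ge> 0" "t * (c - w \<bullet> z) \<ge> 0"
      using t le by auto
    ultimately have "(1 - t) * (c - w \<bullet> y) = 0" "t * (c - w \<bullet> z) = 0"
      by linarith+
    then have eq: "w \<bullet> y = c" "w \<bullet> z = c"
      using t by auto
    \<comment> \<open>The determinant of \<open>y\<close> and \<open>z\<close>: distinct points of a
      line that misses the origin are linearly independent.\<close>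
    define D where "D = y$1 * z$2 - y$2 * z$1"
    have "D \<noteq> 0"
    proof
      assume D: "D = 0"
      have "c * (z$1 - y$1) = (w \<bullet> y) * z$1 - (w \<bullet> z) * y$1"
        using eq by (simp add: algebra_simps)
      also have "\<dots> = - w$2 * D" by (simp add: D_def inner_real2 algebra_simps)
      finally have "z$1 = y$1" using c0 D by simp
      moreover have "c * (z$2 - y$2) = (w \<bullet> y) * z$2 - (w \<bullet> z) * y$2"
        using eq by (simp add: algebra_simps)
      then have "c * (z$2 - y$2) = w$1 * D" by (simp add: D_def inner_real2 algebra_simps)
      then have "z$2 = y$2" using c0 D by simp
      ultimately show False using \<open>y \<noteq> z\<close> by (simp add: eq_real2_iff)
    qed
    \<comment> \<open>Coordinates with respect to \<open>y\<close> and \<open>z\<close>, by Cramer's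
      rule. At \<open>x\<close> both are positive, hence also far along the sequence.\<close>
    define \<alpha> where "\<alpha> p = (p$1 * z$2 - p$2 * z$1) / D" for p :: "real^2"
    define \<beta> where "\<beta> p = (y$1 * p$2 - y$2 * p$1) / D" for p :: "real^2"
    have dec: "p = \<alpha> p *\<^sub>R y + \<beta> p *\<^sub>R z" for p
      using \<open>D \<noteq> 0\<close>
      by (simp add: eq_real2_iff \<alpha>_def \<beta>_def field_simps) (simp add: D_def algebra_simps)
    have "\<alpha> x = 1 - t" "\<beta> x = t"
      using \<open>D \<noteq> 0\<close> by (auto simp: t(3) \<alpha>_def \<beta>_def field_simps) (auto simp: D_def algebra_simps)
    moreover have "(\<lambda>n. \<alpha> (f n)) \<longlonglongrightarrow> \<alpha> x" "(\<lambda>n. \<beta> (f n)) \<longlonglongrightarrow> \<beta> x"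
      unfolding \<alpha>_def \<beta>_def using \<open>D \<noteq> 0\<close> by (auto intro!: tendsto_intros lim)
    ultimately have "\<forall>\<^sub>F n in sequentially. \<alpha> (f n) > 0" "\<forall>\<^sub>F n in sequentially. \<beta> (f n) > 0"
      using t by (auto intro: order_tendstoD)
    then have "\<forall>\<^sub>F n in sequentially. \<alpha> (f n) > 0 \<and> \<beta> (f n) > 0"
      by eventually_elim auto
    then obtain n where pos: "\<alpha> (f n) > 0" "\<beta> (f n) > 0"
      using eventually_happens'[OF sequentially_bot] by blast
    let ?a = "\<alpha> (f n)" and ?b = "\<beta> (f n)"
    \<comment> \<open>Unit norm of \<open>f n\<close> makes the coordinate sum at least 1, and
      \<open>w\<close> makes it at most 1, so \<open>f n\<close> falls inside the open segment and
      cannot be extreme.\<close>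
    have "1 \<le> \<nu> (?a *\<^sub>R y) + \<nu> (?b *\<^sub>R z)"
      using is_normD(4)[OF assms, of "?a *\<^sub>R y" "?b *\<^sub>R z"] f1[of n] dec[of "f n"] by simp
    also have "\<dots> \<le> ?a * 1 + ?b * 1"
      using pos yz by (simp add: is_normD(3)[OF assms] add_mono)
    finally have "1 \<le> ?a + ?b" by simp
    moreover have "w \<bullet> f n = c * (?a + ?b)"
      by (subst dec[of "f n"]) (simp add: inner_add_right eq algebra_simps)
    then have "c * (?a + ?b) \<le> c * 1"
      using w(2)[of "f n"] f1 by (simp add: c_def)
    then have "?a + ?b \<le> 1"
      using c0 mult_le_cancel_left_pos by blast
    ultimately have "?a = 1 - ?b" by simp
    then have "f n \<in> open_segment y z"
      using dec[of "f n"] pos \<open>y \<noteq> z\<close> by (auto simp: in_segment intro!: exI[of _ ?b])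
    then show False
      using f yz by (auto simp: Ext_def extreme_point_of_def unit_ball_def)
  qed
qed

text \<open>An isolated extreme point \<open>x\<close> of the ball can be strictly separated from the convex hull
  of the other extreme points, and then the face in a direction close to the separating one is
  \<open>{x}\<close>.\<close>

lemma perfect_Ext_unit_ball:
  assumes "is_norm \<nu>"
    and faces: "\<And>w \<delta>. \<delta> > 0 \<Longrightarrow> \<exists>w'. norm (w' - w) < \<delta> \<and>
      (\<exists>a b. a \<noteq> b \<and> \<nu> a \<le> 1 \<and> \<nu> b \<le> 1 \<and> (\<forall>x. \<nu> x \<le> 1 \<longrightarrow> w' \<bullet> x \<le> w' \<bullet> a \<and> w' \<bullet> x \<le> w' \<bullet> b))"
  shows "perfect_in (norm_topology \<nu>) (Ext (unit_ball \<nu>))"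
proof -
  define B where "B = unit_ball \<nu>"
  define E where "E = Ext B"
  have B: "compact B" "convex B"
    unfolding B_def using assms(1) by (auto intro: compact_unit_ball convex_unit_ball)
  have EB: "E \<subseteq> B"
    by (auto simp: E_def Ext_def extreme_point_of_def)
  have KM: "B = convex hull E"
    unfolding E_def Ext_def by (rule Krein_Milman_Minkowski[OF B])
  have "0 \<in> B"
    using is_normD(2)[OF assms(1), of 0] by (simp add: B_def unit_ball_def)
  then have "E \<noteq> {}" using KM by auto
  have clE: "closed E"
    unfolding E_def B_def by (rule closed_Ext_unit_ball[OF assms(1)])
  have "x islimpt E" if "x \<in> E" for x
  proof (rule ccontr)
    assume "\<not> x islimpt E"
    then obtain T where T: "open T" "x \<in> T" "\<forall>y\<in>E. y \<in> T \<longrightarrow> y = x"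
      by (auto simp: islimpt_def)
    define C where "C = convex hull (E - {x})"
    \<comment> \<open>Isolation enters here: deleting \<open>x\<close> from \<open>E\<close> amounts
      to deleting the open set \<open>T\<close>, so what remains is closed.\<close>
    have "E - {x} = E - T" using T by auto
    then have "closed (E - {x})" using clE T(1) by (simp add: closed_Diff)
    moreover have bB: "bounded B" using B(1) compact_imp_bounded by blast
    ultimately have "compact (E - {x})"
      using EB by (meson Diff_subset bounded_subset compact_eq_bounded_closed order_trans)
    then have C: "compact C"
      unfolding C_def by (rule compact_convex_hull)
    have CB: "C \<subseteq> B"
      unfolding C_def using EB B(2) by (intro hull_minimal) auto
    \<comment> \<open>Otherwise \<open>C\<close> would be the whole ball with \<open>x\<close>
      extreme in it, but extreme points of a convex hull belong to the generating set.\<close>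
    have "x \<notin> C"
    proof
      assume "x \<in> C"
      then have "E \<subseteq> C"
        unfolding C_def using hull_subset[of "E - {x}" convex] by auto
      then have "B \<subseteq> C"
        unfolding KM by (intro hull_minimal) (simp_all add: C_def)
      with CB have "x extreme_point_of C"
        using \<open>x \<in> E\<close> by (simp add: E_def Ext_def)
      then show False
        unfolding C_def using extreme_point_of_convex_hull by blast
    qed
    then obtain v b where v: "v \<bullet> x < b" "\<And>y. y \<in> C \<Longrightarrow> b < v \<bullet> y"
      using separating_hyperplane_closed_point[of C x] C
      by (metis C_def compact_imp_closed convex_convex_hull)
    obtain R where R: "R > 0" "\<And>y. y \<in> B \<Longrightarrow> norm y \<le> R"
      using bB bounded_pos by metis
    \<comment> \<open>Differences of points of the ball have Euclidean norm at most
      \<open>2 * R\<close>, so with this tolerance passing from \<open>- v\<close> to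
      \<open>w'\<close> cannot use up the gap \<open>b - v \<bullet> x\<close> between
      \<open>x\<close> and \<open>C\<close>.\<close>
    obtain w' a a' where w': "norm (w' - (- v)) < (b - v \<bullet> x) / (2 * R)" "a \<noteq> a'" "a \<in> B" "a' \<in> B"
      and face: "\<And>y. y \<in> B \<Longrightarrow> w' \<bullet> y \<le> w' \<bullet> a" "\<And>y. y \<in> B \<Longrightarrow> w' \<bullet> y \<le> w' \<bullet> a'"
      using faces[of "(b - v \<bullet> x) / (2 * R)" "- v"] v(1) R(1) by (auto simp: B_def unit_ball_def)
    have xB: "x \<in> B" using \<open>x \<in> E\<close> EB by auto
    have gt: "w' \<bullet> y < w' \<bullet> x" if "y \<in> C" for y
    proof -
      have "norm (x - y) \<le> 2 * R"
        using R(2)[OF xB] R(2)[of y] that CB norm_triangle_ineq4[of x y] by auto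
      then have "\<bar>(w' - (- v)) \<bullet> (x - y)\<bar> \<le> norm (w' - (- v)) * (2 * R)"
        by (metis Cauchy_Schwarz_ineq2 mult_left_mono norm_ge_zero order_trans)
      also have "\<dots> < b - v \<bullet> x"
        using w'(1) R(1) by (simp add: field_simps)
      finally show ?thesis
        using v(2)[OF that] by (simp add: inner_simps)
    qed
    \<comment> \<open>Every point of the ball lies on a segment from \<open>x\<close> to a point of
      \<open>C\<close>, along which \<open>w'\<close> strictly decreases. Thus both \<open>a\<close>
      and \<open>a'\<close> would have to be \<open>x\<close>.\<close>
    have "p = x" if p: "p \<in> B" "w' \<bullet> x \<le> w' \<bullet> p" for p
    proof (cases "E - {x} = {}")
      case True
      then have "E = {x}" using \<open>x \<in> E\<close> by auto
      then show ?thesis using p(1) KM by auto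
    next
      case False
      have "p \<in> convex hull (insert x (E - {x}))"
        using p(1) KM \<open>x \<in> E\<close> by (simp add: insert_absorb)
      then obtain s t y where st: "s \<ge> 0" "t \<ge> 0" "s + t = 1" "y \<in> C" "p = s *\<^sub>R x + t *\<^sub>R y"
        unfolding convex_hull_insert[OF False] C_def by blast
      have s: "s = 1 - t" using st(3) by simp
      have "w' \<bullet> p = w' \<bullet> x - t * (w' \<bullet> x - w' \<bullet> y)"
        unfolding st(5) s by (simp add: inner_add_right algebra_simps)
      then have "t * (w' \<bullet> x - w' \<bullet> y) \<le> 0" using p(2) by simp
      then have "t = 0" using gt[OF st(4)] st(2) by (simp add: mult_le_0_iff)
      then show ?thesis using st by simp
    qed
    then show False
      using face xB w' by metis
  qed
  then show ?thesis
    using \<open>E \<noteq> {}\<close> clE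
    unfolding perfect_in_def norm_topology_euclidean[OF assms(1)] E_def B_def
    by (auto simp: derived_set_of_def islimpt_def)
qed

text \<open>A perfect set equals its derived set, and in a complete metric space such a nonempty set
  contains an injective image of the reals.\<close>

lemma uncountable_perfect:
  fixes P :: "'a::euclidean_space set"
  assumes "perfect_in euclidean P"
  shows "uncountable P"
proof -
  have "euclidean derived_set_of P = P"
    using assms by (auto simp: perfect_in_def closedin_contains_derived_set)
  then have "(UNIV :: real set) \<lesssim> P"
    using assms by (intro lepoll_perfect_set[of euclidean])
      (auto simp: perfect_in_def completely_metrizable_space_euclidean)
  then show ?thesis
    using uncountable_UNIV_real countable_lepoll by blast
qed

subsection \<open>Rational directions\<close>

text \<open>Integrality makes \<open>g k \<bullet> x\<close> an integer at lattice points, and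
  \<open>g_indep\<close> keeps different sides nonparallel. Density is up to real multiples and asks
  for indices from 2 on, because only those sides come from cuts.\<close>

locale directions =
  fixes g :: "nat \<Rightarrow> real^2"
  assumes g_0: "g 0 = axis 1 1" and g_1: "g 1 = axis 2 1"
    and g_Ints: "g k $ c \<in> \<int>"
    and g_indep: "i \<noteq> j \<Longrightarrow> g i $ 1 * g j $ 2 \<noteq> g i $ 2 * g j $ 1"
    and g_dense: "\<delta> > 0 \<Longrightarrow> \<exists>k\<ge>2. \<exists>s. norm (s *\<^sub>R g k - w) < \<delta>"

lemma nonzero_rat_approx:
  fixes a \<delta> :: real
  assumes "\<delta> > 0"
  obtains r :: rat where "r \<noteq> 0" "\<bar>of_rat r - a\<bar> < \<delta>"
proof -
  \<comment> \<open>The open interval from \<open>b\<close> to \<open>b + \<delta>\<close> lies on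
    one side of 0, so every rational in it is nonzero.\<close>
  define b where "b = (if a < 0 then a - \<delta> else a)"
  have "b < b + \<delta>" using assms by simp
  then obtain r where r: "b < of_rat r" "of_rat r < b + \<delta>"
    using of_rat_dense by blast
  then have "r \<noteq> 0" "\<bar>of_rat r - a\<bar> < \<delta>"
    using assms by (auto simp: b_def split: if_splits)
  then show ?thesis by (rule that)
qed

text \<open>A nonzero rational, as a reduced fraction, gives the vector of its numerator and
  denominator; different rationals give nonparallel vectors. The two axes are listed first, hence
  the index shift by 2.\<close>

lemma directions_exist: "\<exists>g. directions g"
proof -
  define Q where "Q = {r::rat. r \<noteq> 0}"
  have "infinite Q"
    unfolding Q_def using infinite_UNIV_char_0[where 'a=rat] by (simp add: Collect_neg_eq)
  then have bij: "bij_betw (from_nat_into Q) UNIV Q"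
    by (intro bij_betw_from_nat_into) simp_all
  define q where "q = from_nat_into Q"
  have inj: "q i = q j \<longleftrightarrow> i = j" for i j
    using bij unfolding q_def bij_betw_def inj_on_def by blast
  have q0: "q i \<noteq> 0" for i
    using bij unfolding q_def bij_betw_def Q_def by blast
  have surj: "\<exists>i. q i = r" if "r \<noteq> 0" for r
    using bij that unfolding q_def bij_betw_def Q_def by (metis (mono_tags) imageE mem_Collect_eq)
  define num where "num k = real_of_int (fst (quotient_of (q k)))" for k
  define den where "den k = real_of_int (snd (quotient_of (q k)))" for k
  have den: "den k > 0" for k
    unfolding den_def using quotient_of_denom_pos' by simp
  have q_eq: "real_of_rat (q k) = num k / den k" for k
    using arg_cong[OF quotient_of_div[OF prod.collapse[symmetric]], of real_of_rat "q k"]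
    by (simp add: num_def den_def of_rat_divide)
  have num: "num k \<noteq> 0" for k
    using q_eq[of k] q0[of k] by auto
  define g where "g k = (if k = 0 then axis 1 1 else if k = 1 then axis 2 1
    else (\<chi> i. if i = 1 then num (k - 2) else den (k - 2)) :: real^2)" for k
  have g1: "g k $ 1 = (if k = 0 then 1 else if k = 1 then 0 else num (k - 2))" for k
    by (simp add: g_def axis_def)
  have g2: "g k $ 2 = (if k = 0 then 0 else if k = 1 then 1 else den (k - 2))" for k
    by (simp add: g_def axis_def)
  have "directions g"
  proof
    show "g 0 = axis 1 1" "g 1 = axis 2 1" by (simp_all add: g_def)
    show "g k $ i \<in> \<int>" for k i
      using exhaust_2[of i] by (auto simp: g1 g2 num_def den_def)
    show "g i $ 1 * g j $ 2 \<noteq> g i $ 2 * g j $ 1" if "i \<noteq> j" for i j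
    proof (cases "i < 2 \<or> j < 2")
      case True
      then show ?thesis
        using that num den by (auto simp: g1 g2 less_2_cases_iff less_imp_neq[symmetric])
    next
      case False
      then have "i - 2 \<noteq> j - 2"
        using that by linarith
      then have "q (i - 2) \<noteq> q (j - 2)"
        by (simp add: inj)
      then have "num (i - 2) / den (i - 2) \<noteq> num (j - 2) / den (j - 2)"
        by (metis q_eq of_rat_eq_iff)
      then show ?thesis
        using den[of "i - 2"] den[of "j - 2"] False by (auto simp: g1 g2 field_simps)
    qed
    show "\<exists>k\<ge>2. \<exists>s. norm (s *\<^sub>R g k - w) < \<delta>" if "\<delta> > 0" for \<delta> w
    proof -
      have \<delta>: "\<delta> / 2 > 0" using that by simp
      obtain r1 where r1: "r1 \<noteq> 0" "\<bar>of_rat r1 - w$1\<bar> < \<delta> / 2"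
        using nonzero_rat_approx[OF \<delta>] by blast
      obtain r2 where r2: "r2 \<noteq> 0" "\<bar>of_rat r2 - w$2\<bar> < \<delta> / 2"
        using nonzero_rat_approx[OF \<delta>] by blast
      obtain k where k: "q k = r1 / r2"
        using surj[of "r1 / r2"] r1 r2 by auto
      define s where "s = real_of_rat r2 / den k"
      have "real_of_rat r1 = real_of_rat r2 * (num k / den k)"
        using k r2(1) by (simp flip: q_eq add: of_rat_divide)
      then have "(s *\<^sub>R g (k + 2)) $ 1 = of_rat r1" "(s *\<^sub>R g (k + 2)) $ 2 = of_rat r2"
        using den[of k] by (simp_all add: g1 g2 s_def)
      then have "norm (s *\<^sub>R g (k + 2) - w) < \<delta>"
        using norm_le_l1_cart[of "s *\<^sub>R g (k + 2) - w"] r1(2) r2(2) by (simp add: sum_2)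
      then show ?thesis by (meson le_add2)
    qed
  qed
  then show ?thesis by blast
qed

text \<open>The quarter turn: \<open>perp (g i)\<close> points along the sides with normal
  \<open>g i\<close>.\<close>

definition perp :: "real^2 \<Rightarrow> real^2" where
  "perp v = (\<chi> i. if i = 1 then - v$2 else v$1)"

lemma inner_perp: "u \<bullet> perp v = u$2 * v$1 - u$1 * v$2"
  by (simp add: inner_real2 perp_def)

lemma perp_eq_0_iff: "perp v = 0 \<longleftrightarrow> v = 0"
  by (auto simp: perp_def eq_real2_iff)

subsection \<open>Cutting one corner of a polygon\<close>

context directions
begin

definition wt :: "(nat \<Rightarrow> real) \<Rightarrow> nat \<Rightarrow> real^2 \<Rightarrow> real" where
  "wt l i x = l i * \<bar>g i \<bullet> x\<bar>"

text \<open>The gauge of the polygon bounded by the first \<open>k\<close> pairs of parallel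
  sides.\<close>

definition nu :: "(nat \<Rightarrow> real) \<Rightarrow> nat \<Rightarrow> real^2 \<Rightarrow> real" where
  "nu l k x = Max ((\<lambda>i. wt l i x) ` {..<k})"

text \<open>Geometrically, the ray through \<open>x\<close> leaves the polygon inside a side and not
  at a corner. The origin is excluded once \<open>k \<ge> 2\<close>.\<close>

definition unique_max :: "(nat \<Rightarrow> real) \<Rightarrow> nat \<Rightarrow> real^2 \<Rightarrow> bool" where
  "unique_max l k x \<longleftrightarrow> (\<exists>i<k. \<forall>j<k. j \<noteq> i \<longrightarrow> wt l j x < wt l i x)"

definition height :: "nat \<Rightarrow> nat" where
  "height i = nat \<lceil>\<bar>g i $ 1\<bar> + \<bar>g i $ 2\<bar>\<rceil>"

text \<open>This depends on the directions and not on the coefficients \<open>l\<close>, so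
  thresholds can be chosen before any cut. The sum accounts for multiples of side coefficients;
  \<open>4 * K * K\<close> accounts for at most \<open>2 * K * K\<close> lines of tied points, with
  at most \<open>2 * N\<close> distances each.\<close>

definition count_bound :: "nat \<Rightarrow> nat" where
  "count_bound K = (\<Sum>i<K. height i + 1) + 4 * K * K"

lemma nu_cong: "(\<And>i. i < k \<Longrightarrow> l i = l' i) \<Longrightarrow> nu l k x = nu l' k x"
  unfolding nu_def wt_def by (intro arg_cong[where f=Max] image_cong) auto

lemma unique_max_cong: "(\<And>i. i < k \<Longrightarrow> l i = l' i) \<Longrightarrow> unique_max l k x = unique_max l' k x"
  unfolding unique_max_def wt_def by auto

lemma wt_le_nu: "i < k \<Longrightarrow> wt l i x \<le> nu l k x"
  unfolding nu_def by (intro Max_ge) auto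

lemma nu_le_iff: "k > 0 \<Longrightarrow> nu l k x \<le> c \<longleftrightarrow> (\<forall>i<k. wt l i x \<le> c)"
  unfolding nu_def by (subst Max_le_iff) auto

lemma nu_less_iff: "k > 0 \<Longrightarrow> nu l k x < c \<longleftrightarrow> (\<forall>i<k. wt l i x < c)"
  unfolding nu_def by (subst Max_less_iff) auto

lemma nu_attained:
  assumes "k > 0"
  obtains i where "i < k" "nu l k x = wt l i x"
proof -
  have "nu l k x \<in> (\<lambda>i. wt l i x) ` {..<k}"
    unfolding nu_def using assms by (intro Max_in) auto
  then show ?thesis using that by auto
qed

lemma nu_eqI: "i < k \<Longrightarrow> (\<And>j. j < k \<Longrightarrow> wt l j x \<le> wt l i x) \<Longrightarrow> nu l k x = wt l i x"
  unfolding nu_def by (intro Max_eqI) auto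

lemma wt_scaleR: "wt l i (c *\<^sub>R x) = \<bar>c\<bar> * wt l i x"
  by (simp add: wt_def abs_mult)

lemma nu_scaleR:
  assumes "k > 0"
  shows "nu l k (c *\<^sub>R x) = \<bar>c\<bar> * nu l k x"
proof -
  obtain i where i: "i < k" "nu l k x = wt l i x"
    using nu_attained[OF assms] .
  have "nu l k (c *\<^sub>R x) = wt l i (c *\<^sub>R x)"
    using i(1) by (intro nu_eqI) (auto simp: wt_scaleR i(2)[symmetric] intro!: mult_left_mono wt_le_nu)
  then show ?thesis by (simp add: wt_scaleR i(2))
qed

lemma abs_component_le_nu:
  assumes "l 0 = 1" "l 1 = 1" "k \<ge> 2"
  shows "\<bar>x$1\<bar> \<le> nu l k x" "\<bar>x$2\<bar> \<le> nu l k x"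
  using wt_le_nu[of 0 k l x] wt_le_nu[of 1 k l x] assms g_0 g_1
  by (simp_all add: wt_def inner_axis')

lemma nu_pos:
  assumes "l 0 = 1" "l 1 = 1" "k \<ge> 2" "x \<noteq> 0"
  shows "nu l k x > 0"
  using abs_component_le_nu[OF assms(1-3), of x] assms(4) by (auto simp: eq_real2_iff)

lemma tendsto_wt_at_right_0: "((\<lambda>t. wt l j (x + t *\<^sub>R d)) \<longlongrightarrow> wt l j x) (at_right 0)"
proof -
  have "((\<lambda>t. wt l j (x + t *\<^sub>R d)) \<longlongrightarrow> wt l j (x + 0 *\<^sub>R d)) (at_right 0)"
    unfolding wt_def by (intro tendsto_intros)
  then show ?thesis by simp
qed

text \<open>A point where only the functional of \<open>g i\<close> is maximal lies inside a side of its polygon, and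
  moving it along that side increases \<open>g k\<close>.\<close>

lemma unique_max_strict:
  assumes "\<And>y. \<bar>g k \<bullet> y\<bar> \<le> h * nu l k y" and "unique_max l k x"
  shows "\<bar>g k \<bullet> x\<bar> < h * nu l k x"
proof -
  obtain i where i: "i < k" "\<And>j. j < k \<Longrightarrow> j \<noteq> i \<Longrightarrow> wt l j x < wt l i x"
    using assms(2) by (auto simp: unique_max_def)
  define D where "D = g k \<bullet> perp (g i)"
  have "D \<noteq> 0"
    using g_indep[of k i] i(1) by (simp add: D_def inner_perp mult.commute)
  \<comment> \<open>The sign lets the displacement agree in sign with
    \<open>g k \<bullet> x\<close>, so that the absolute values add.\<close>
  define s :: real where "s = (if (g k \<bullet> x) * D \<ge> 0 then 1 else - 1)"
  define d where "d = s *\<^sub>R perp (g i)"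
  have gd: "\<bar>g k \<bullet> (x + t *\<^sub>R d)\<bar> = \<bar>g k \<bullet> x\<bar> + t * \<bar>D\<bar>" if "t > 0" for t
  proof -
    have "g k \<bullet> (x + t *\<^sub>R d) = g k \<bullet> x + t * (s * D)"
      by (simp add: d_def D_def inner_add_right)
    moreover have "(g k \<bullet> x) * (t * (s * D)) \<ge> 0"
      using that by (auto simp: s_def zero_le_mult_iff mult_le_0_iff not_le)
    moreover have "\<bar>t * (s * D)\<bar> = t * \<bar>D\<bar>"
      using that by (simp add: abs_mult s_def)
    ultimately show ?thesis
      by (smt (verit) zero_le_mult_iff)
  qed
  have wi: "wt l i (x + t *\<^sub>R d) = wt l i x" for t
    by (simp add: wt_def d_def inner_add_right inner_perp algebra_simps)
  have "\<forall>\<^sub>F t in at_right 0. \<forall>j\<in>{..<k} - {i}. wt l j (x + t *\<^sub>R d) < wt l i x"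
    using i(2) by (intro eventually_ball_finite ballI order_tendstoD[OF tendsto_wt_at_right_0]) auto
  then have "\<forall>\<^sub>F t in at_right 0. t > 0 \<and> (\<forall>j\<in>{..<k} - {i}. wt l j (x + t *\<^sub>R d) < wt l i x)"
    using eventually_at_right_less[of 0] by eventually_elim auto
  then obtain t where t: "t > 0" "\<And>j. j < k \<Longrightarrow> j \<noteq> i \<Longrightarrow> wt l j (x + t *\<^sub>R d) < wt l i x"
    using eventually_happens'[OF trivial_limit_at_right_real] by (metis (no_types, lifting) Diff_iff lessThan_iff singletonD)
  have "nu l k (x + t *\<^sub>R d) = wt l i (x + t *\<^sub>R d)"
    using i(1) t(2) by (intro nu_eqI) (force simp: wi)+
  moreover have "nu l k x = wt l i x"
    using i by (intro nu_eqI) force+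
  ultimately have "\<bar>g k \<bullet> x\<bar> + t * \<bar>D\<bar> \<le> h * nu l k x"
    using assms(1)[of "x + t *\<^sub>R d"] gd[OF t(1)] by (simp add: wi)
  moreover have "t * \<bar>D\<bar> > 0" using t(1) \<open>D \<noteq> 0\<close> by simp
  ultimately show ?thesis by linarith
qed

text \<open>If \<open>h\<close> is the maximum of \<open>g k\<close> on the polygon, the coefficient
  \<open>1 / h\<close> gives a line touching it. The inequality on \<open>P\<close> is already
  strict there, and finitely many strict inequalities survive a slightly larger \<open>c\<close>.
  The lower bound for \<open>c\<close> holds because the polygon lies in the square, however small
  the cut.\<close>

lemma corner_cut:
  assumes l: "l 0 = 1" "l 1 = 1" and k: "k \<ge> 2"
    and P: "finite P" "\<And>x. x \<in> P \<Longrightarrow> unique_max l k x"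
  obtains c a b where "c > 0" "c * (\<bar>g k $ 1\<bar> + \<bar>g k $ 2\<bar>) \<ge> 1"
    "\<And>x. x \<in> P \<Longrightarrow> c * \<bar>g k \<bullet> x\<bar> < nu l k x"
    "a \<noteq> b" "c * (g k \<bullet> a) = 1" "c * (g k \<bullet> b) = 1" "nu l k a < 1" "nu l k b < 1"
proof -
  have k0: "k > 0" using k by simp
  define K where "K = {x. nu l k x \<le> 1}"
  have "K = (\<Inter>i\<in>{..<k}. {x. wt l i x \<le> 1})"
    using nu_le_iff[OF k0] by (auto simp: K_def)
  then have "closed K"
    by (auto simp: wt_def intro!: closed_INT closed_Collect_le continuous_intros)
  moreover have "norm x \<le> 2" if "x \<in> K" for x
    using abs_component_le_nu[OF l k, of x] that norm_le_l1_cart[of x] by (simp add: K_def sum_2)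
  then have "bounded K" by (auto simp: bounded_iff)
  ultimately have "compact K" by (simp add: compact_eq_bounded_closed)
  moreover have "0 \<in> K"
    using nu_scaleR[OF k0, of l 0 0] by (simp add: K_def)
  ultimately obtain v where v: "v \<in> K" "\<And>y. y \<in> K \<Longrightarrow> g k \<bullet> y \<le> g k \<bullet> v"
    using continuous_attains_sup[of K "\<lambda>x. g k \<bullet> x"] by (fastforce intro: continuous_intros)
  define h where "h = g k \<bullet> v"
  have gk: "g k \<noteq> 0"
    using g_indep[of k "k + 1"] by auto
  have le: "g k \<bullet> y \<le> h * nu l k y" for y
  proof (cases "y = 0")
    case False
    have p: "nu l k y > 0" by (rule nu_pos[OF l k False])
    then have "(1 / nu l k y) *\<^sub>R y \<in> K"
      by (simp add: K_def nu_scaleR[OF k0])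
    from v(2)[OF this] show ?thesis
      using p by (simp add: h_def field_simps)
  qed (use nu_scaleR[OF k0, of l 0 0] in simp)
  have abs_le: "\<bar>g k \<bullet> y\<bar> \<le> h * nu l k y" for y
    using le[of y] le[of "- y"] nu_scaleR[OF k0, of l "-1" y] by simp
  have h: "h > 0"
  proof -
    have "g k \<bullet> g k > 0" using gk by simp
    then have "h * nu l k (g k) > 0" using le[of "g k"] by linarith
    then show ?thesis using nu_pos[OF l k gk] by (simp add: zero_less_mult_iff)
  qed
  have "\<forall>x\<in>P. (1 / h) * \<bar>g k \<bullet> x\<bar> < nu l k x"
    using unique_max_strict[OF abs_le P(2)] h by (simp add: field_simps)
  then have "\<forall>\<^sub>F c in at_right (1 / h). \<forall>x\<in>P. c * \<bar>g k \<bullet> x\<bar> < nu l k x"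
    using P(1) by (intro eventually_ball_finite ballI) (auto intro!: order_tendstoD(2) tendsto_intros)
  then have "\<forall>\<^sub>F c in at_right (1 / h). 1 / h < c \<and> (\<forall>x\<in>P. c * \<bar>g k \<bullet> x\<bar> < nu l k x)"
    using eventually_at_right_less[of "1 / h"] by eventually_elim auto
  then obtain c where c: "1 / h < c" "\<And>x. x \<in> P \<Longrightarrow> c * \<bar>g k \<bullet> x\<bar> < nu l k x"
    using eventually_happens'[OF trivial_limit_at_right_real] by blast
  have c0: "c > 0" using c(1) h by (meson less_trans zero_less_divide_1_iff)
  have ch: "c * h > 1" using c(1) h by (simp add: field_simps)
  have "h \<le> \<bar>g k $ 1\<bar> * \<bar>v $ 1\<bar> + \<bar>g k $ 2\<bar> * \<bar>v $ 2\<bar>"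
    unfolding h_def inner_real2 by (intro add_mono) (simp_all flip: abs_mult)
  also have "\<dots> \<le> \<bar>g k $ 1\<bar> * 1 + \<bar>g k $ 2\<bar> * 1"
    using abs_component_le_nu[OF l k, of v] v(1) by (intro add_mono mult_left_mono) (auto simp: K_def)
  finally have "c * h \<le> c * (\<bar>g k $ 1\<bar> + \<bar>g k $ 2\<bar>)"
    using c0 by simp
  then have low: "c * (\<bar>g k $ 1\<bar> + \<bar>g k $ 2\<bar>) \<ge> 1" using ch by linarith
  \<comment> \<open>The maximal point \<open>v\<close> is pulled radially onto the new side,
    strictly inside the old polygon. A short shift along that side then supplies the second
    point.\<close>
  define a where "a = (1 / (c * h)) *\<^sub>R v"
  have a: "c * (g k \<bullet> a) = 1"
    using c0 h by (simp add: a_def h_def[symmetric])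
  have "nu l k a = nu l k v / (c * h)"
    using ch by (simp add: a_def nu_scaleR[OF k0] abs_of_pos)
  also have "\<dots> < 1"
    using v(1) ch by (simp add: K_def)
  finally have na: "nu l k a < 1" .
  define d where "d = perp (g k)"
  have "\<forall>\<^sub>F t in at_right 0. \<forall>j\<in>{..<k}. wt l j (a + t *\<^sub>R d) < 1"
    using na by (intro eventually_ball_finite ballI order_tendstoD[OF tendsto_wt_at_right_0])
      (auto simp: nu_less_iff[OF k0])
  then have "\<forall>\<^sub>F t in at_right 0. t > 0 \<and> (\<forall>j\<in>{..<k}. wt l j (a + t *\<^sub>R d) < 1)"
    using eventually_at_right_less[of 0] by eventually_elim auto
  then obtain t where t: "t > 0" "\<And>j. j < k \<Longrightarrow> wt l j (a + t *\<^sub>R d) < 1"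
    using eventually_happens'[OF trivial_limit_at_right_real] by (metis (no_types, lifting) lessThan_iff)
  have "a \<noteq> a + t *\<^sub>R d"
    using t(1) gk by (simp add: d_def perp_eq_0_iff)
  moreover have "c * (g k \<bullet> (a + t *\<^sub>R d)) = 1"
    using a by (simp add: d_def inner_add_right inner_perp)
  moreover have "nu l k (a + t *\<^sub>R d) < 1"
    using t(2) by (simp add: nu_less_iff[OF k0])
  ultimately show ?thesis
    using that[OF c0 low c(2)] a na by blast
qed

end

subsection \<open>The limit norm\<close>

definition lattice :: "(real^2) set" where
  "lattice = {x. \<forall>i. x$i \<in> \<int>}"

lemma finite_bounded_lattice: "finite {x\<in>lattice. \<bar>x$1\<bar> \<le> real m \<and> \<bar>x$2\<bar> \<le> real m}"
proof -
  let ?f = "\<lambda>(i::int, j::int). (\<chi> c. if c = 1 then real_of_int i else real_of_int j) :: real^2"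
  have "{x\<in>lattice. \<bar>x$1\<bar> \<le> real m \<and> \<bar>x$2\<bar> \<le> real m} \<subseteq> ?f ` ({- int m..int m} \<times> {- int m..int m})"
  proof
    fix x assume x: "x \<in> {x\<in>lattice. \<bar>x$1\<bar> \<le> real m \<and> \<bar>x$2\<bar> \<le> real m}"
    then have "x$1 \<in> \<int>" "x$2 \<in> \<int>"
      by (auto simp: lattice_def)
    then obtain i j where "x$1 = of_int i" "x$2 = of_int j"
      by (elim Ints_cases)
    then show "x \<in> ?f ` ({- int m..int m} \<times> {- int m..int m})"
      using x by (intro image_eqI[of _ _ "(i, j)"]) (auto simp: eq_real2_iff)
  qed
  then show ?thesis by (rule finite_subset) simp
qed

section \<open>The infinite sequence of cuts\<close>

text \<open>\<open>A k\<close> and \<open>B k\<close> witness that the \<open>k\<close>-th side is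
  nondegenerate. \<open>AB_old\<close> covers later sides as well as earlier ones, so the segment
  between them survives all cuts. \<open>lattice_uncut\<close> expresses how small the cut
  is.\<close>

locale corner_cutting = directions +
  fixes M :: "nat \<Rightarrow> nat" and l :: "nat \<Rightarrow> real" and A B :: "nat \<Rightarrow> real^2"
  assumes M_mono: "mono M" and M_pos: "M k \<ge> 1"
    and l_0: "l 0 = 1" and l_1: "l 1 = 1" and l_pos: "l k > 0"
    and l_lower: "l k * (\<bar>g k $ 1\<bar> + \<bar>g k $ 2\<bar>) \<ge> 1"
    and lattice_uncut: "k \<ge> 2 \<Longrightarrow> x \<in> lattice \<Longrightarrow> unique_max l k x \<Longrightarrow> nu l k x \<le> real (M k) \<Longrightarrow>
      wt l k x < nu l k x"
    and AB_neq: "k \<ge> 2 \<Longrightarrow> A k \<noteq> B k"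
    and AB_new: "k \<ge> 2 \<Longrightarrow> l k * (g k \<bullet> A k) = 1" "k \<ge> 2 \<Longrightarrow> l k * (g k \<bullet> B k) = 1"
    and AB_old: "i \<noteq> k \<Longrightarrow> k \<ge> 2 \<Longrightarrow> wt l i (A k) < 1" "i \<noteq> k \<Longrightarrow> k \<ge> 2 \<Longrightarrow> wt l i (B k) < 1"

text \<open>Each coefficient is chosen together with its two points by recursion. The earlier
  \<open>A j\<close> and \<open>B j\<close> join the relevant lattice points in the finite set that
  \<open>corner_cut\<close> leaves uncut.\<close>

lemma (in directions) corner_cutting_exists:
  assumes M: "mono M" "\<And>k. M k \<ge> 1"
  shows "\<exists>l A B. corner_cutting g M l A B"
proof -
  define l where "l F = (\<lambda>k. fst (F k))" for F :: "nat \<Rightarrow> real \<times> (real^2) \<times> (real^2)"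
  define A where "A F = (\<lambda>k. fst (snd (F k)))" for F :: "nat \<Rightarrow> real \<times> (real^2) \<times> (real^2)"
  define B where "B F = (\<lambda>k. snd (snd (F k)))" for F :: "nat \<Rightarrow> real \<times> (real^2) \<times> (real^2)"
  \<comment> \<open>The clauses for stage \<open>k\<close> look at \<open>F\<close> only below
    \<open>k\<close>, as the recursion requires. Stages 0 and 1 are the sides of the square, where
    the two points are arbitrary.\<close>
  define P where "P F k r = (case r of (c, a, b) \<Rightarrow>
      if k < 2 then c = 1
      else c > 0 \<and> c * (\<bar>g k $ 1\<bar> + \<bar>g k $ 2\<bar>) \<ge> 1 \<and>
        (\<forall>x\<in>lattice. unique_max (l F) k x \<longrightarrow> nu (l F) k x \<le> real (M k) \<longrightarrow> c * \<bar>g k \<bullet> x\<bar> < nu (l F) k x) \<and>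
        (\<forall>j\<in>{2..<k}. c * \<bar>g k \<bullet> A F j\<bar> < 1 \<and> c * \<bar>g k \<bullet> B F j\<bar> < 1) \<and>
        a \<noteq> b \<and> c * (g k \<bullet> a) = 1 \<and> c * (g k \<bullet> b) = 1 \<and> nu (l F) k a < 1 \<and> nu (l F) k b < 1)"
    for F :: "nat \<Rightarrow> real \<times> (real^2) \<times> (real^2)" and k :: nat and r :: "real \<times> (real^2) \<times> (real^2)"
  have abs_eq: "c * \<bar>u\<bar> = 1" if "c > 0" "c * u = 1" for c u :: real
    using that by (metis abs_mult abs_of_pos abs_one)
  have "\<exists>F. \<forall>k. P F k (F k)"
  proof (rule dependent_wf_choice[of "less_than"])
    show "wf less_than" by simp
  next
    fix F G :: "nat \<Rightarrow> real \<times> (real^2) \<times> (real^2)" and k r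
    assume "\<And>j. (j, k) \<in> less_than \<Longrightarrow> F j = G j"
    then have eq: "F j = G j" if "j < k" for j
      using that by simp
    then have "nu (l F) k x = nu (l G) k x" "unique_max (l F) k x = unique_max (l G) k x" for x
      by (auto simp: l_def intro!: nu_cong unique_max_cong)
    then show "P F k r = P G k r"
      using eq by (auto simp: P_def A_def B_def)
  next
    fix k and F :: "nat \<Rightarrow> real \<times> (real^2) \<times> (real^2)"
    assume "\<And>j. (j, k) \<in> less_than \<Longrightarrow> P F j (F j)"
    then have IH: "P F j (l F j, A F j, B F j)" if "j < k" for j
      using that by (simp add: l_def A_def B_def)
    show "\<exists>r. P F k r"
    proof (cases "k < 2")
      case True
      then show ?thesis by (auto simp: P_def)
    next
      case False
      then have k: "k \<ge> 2" by simp
      have l01: "l F 0 = 1" "l F 1 = 1"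
        using IH[of 0] IH[of 1] k by (auto simp: P_def)
      have one: "wt (l F) j (A F j) = 1" "wt (l F) j (B F j) = 1" if "j \<in> {2..<k}" for j
        using IH[of j] that abs_eq by (auto simp: P_def wt_def)
      \<comment> \<open>Sides older than \<open>j\<close> are handled by the bound on
        \<open>nu\<close> at stage \<open>j\<close>, younger ones by the clause protecting
        \<open>A F j\<close> and \<open>B F j\<close>.\<close>
      have lt: "wt (l F) i (A F j) < 1" "wt (l F) i (B F j) < 1" if "j \<in> {2..<k}" "i < k" "i \<noteq> j" for i j
        using that IH[of j] IH[of i]
        by (cases i j rule: linorder_cases; auto simp: P_def wt_def nu_less_iff)+
      define L where "L = {x\<in>lattice. unique_max (l F) k x \<and> nu (l F) k x \<le> real (M k)}"
      have "L \<subseteq> {x\<in>lattice. \<bar>x$1\<bar> \<le> real (M k) \<and> \<bar>x$2\<bar> \<le> real (M k)}"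
        using abs_component_le_nu[OF l01 k] unfolding L_def by (blast intro: order_trans)
      then have "finite L"
        using finite_bounded_lattice finite_subset by blast
      then have fin: "finite (L \<union> A F ` {2..<k} \<union> B F ` {2..<k})" by simp
      have AB: "unique_max (l F) k (A F j) \<and> nu (l F) k (A F j) = 1"
               "unique_max (l F) k (B F j) \<and> nu (l F) k (B F j) = 1" if "j \<in> {2..<k}" for j
      proof -
        have "wt (l F) i (A F j) \<le> 1" "wt (l F) i (B F j) \<le> 1" if "i < k" for i
          using one[OF \<open>j \<in> {2..<k}\<close>] lt[OF \<open>j \<in> {2..<k}\<close> that] by (cases "i = j"; auto)+
        then have "nu (l F) k (A F j) = wt (l F) j (A F j)" "nu (l F) k (B F j) = wt (l F) j (B F j)"
          using that one[OF that] by (intro nu_eqI; simp)+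
        then show "unique_max (l F) k (A F j) \<and> nu (l F) k (A F j) = 1"
               "unique_max (l F) k (B F j) \<and> nu (l F) k (B F j) = 1"
          using that one[OF that] lt[OF that] by (auto simp: unique_max_def intro!: exI[of _ j])
      qed
      then have um: "unique_max (l F) k x" if "x \<in> L \<union> A F ` {2..<k} \<union> B F ` {2..<k}" for x
        using that by (auto simp: L_def)
      obtain c a b where c: "c > 0" "c * (\<bar>g k $ 1\<bar> + \<bar>g k $ 2\<bar>) \<ge> 1"
          "\<And>x. x \<in> L \<union> A F ` {2..<k} \<union> B F ` {2..<k} \<Longrightarrow> c * \<bar>g k \<bullet> x\<bar> < nu (l F) k x"
          "a \<noteq> b" "c * (g k \<bullet> a) = 1" "c * (g k \<bullet> b) = 1" "nu (l F) k a < 1" "nu (l F) k b < 1"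
        using corner_cut[OF l01 k fin um] by blast
      have "c * \<bar>g k \<bullet> A F j\<bar> < 1 \<and> c * \<bar>g k \<bullet> B F j\<bar> < 1" if "j \<in> {2..<k}" for j
        using c(3)[of "A F j"] c(3)[of "B F j"] AB[OF that] that by auto
      then have "P F k (c, a, b)"
        using c False by (auto simp: P_def L_def)
      then show ?thesis ..
    qed
  qed
  then obtain F where F: "\<And>k. P F k (l F k, A F k, B F k)"
    by (auto simp: l_def A_def B_def)
  have l01: "l F 0 = 1" "l F 1 = 1"
    using F[of 0] F[of 1] by (auto simp: P_def)
  have F2: "l F k > 0" "l F k * (\<bar>g k $ 1\<bar> + \<bar>g k $ 2\<bar>) \<ge> 1"
    "\<And>x. x \<in> lattice \<Longrightarrow> unique_max (l F) k x \<Longrightarrow> nu (l F) k x \<le> real (M k) \<Longrightarrow> wt (l F) k x < nu (l F) k x"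
    "\<And>j. j \<in> {2..<k} \<Longrightarrow> wt (l F) k (A F j) < 1 \<and> wt (l F) k (B F j) < 1"
    "A F k \<noteq> B F k" "l F k * (g k \<bullet> A F k) = 1" "l F k * (g k \<bullet> B F k) = 1"
    "nu (l F) k (A F k) < 1" "nu (l F) k (B F k) < 1" if "k \<ge> 2" for k
    using F[of k] that by (auto simp: P_def wt_def)
  have "corner_cutting g M (l F) (A F) (B F)"
  proof
    show "l F k > 0" for k
      using l01 F2(1)[of k] by (cases "k < 2") (auto simp: less_2_cases_iff)
    show "l F k * (\<bar>g k $ 1\<bar> + \<bar>g k $ 2\<bar>) \<ge> 1" for k
      using l01 F2(2)[of k] g_0 g_1 by (cases "k < 2") (auto simp: less_2_cases_iff axis_def)
    show "wt (l F) i (A F k) < 1" "wt (l F) i (B F k) < 1" if "i \<noteq> k" "k \<ge> 2" for i k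
      using F2(4)[of i k] F2(8,9)[of k] that
      by (cases i k rule: linorder_cases; auto simp: nu_less_iff)+
  qed (use M l01 F2 in auto)
  then show ?thesis by blast
qed

context corner_cutting
begin

section \<open>Stability of lattice points under later cuts\<close>

text \<open>Monotonicity of \<open>M\<close> keeps the point within the range protected at every
  later stage, so each new side stays strictly below the maximum.\<close>

lemma lattice_stable:
  assumes "K \<ge> 2" "K \<le> k" "x \<in> lattice" "unique_max l K x" "nu l K x \<le> real (M K)"
  shows "unique_max l k x \<and> nu l k x = nu l K x"
  using assms(2)
proof (induction k rule: dec_induct)
  case (step k)
  have k: "k \<ge> 2" using step assms(1) by simp
  have "M K \<le> M k" using M_mono step by (simp add: monoD)
  then have "nu l k x \<le> real (M k)" using step assms(5) by linarith
  then have lt: "wt l k x < nu l k x"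
    using lattice_uncut[OF k assms(3)] step by blast
  obtain i where i: "i < k" "\<And>j. j < k \<Longrightarrow> j \<noteq> i \<Longrightarrow> wt l j x < wt l i x"
    using step by (auto simp: unique_max_def)
  have nu: "nu l k x = wt l i x"
    using i by (intro nu_eqI) force+
  then have *: "wt l j x < wt l i x" if "j < Suc k" "j \<noteq> i" for j
    using i(2)[of j] lt that by (cases "j = k") auto
  then have "nu l (Suc k) x = wt l i x"
    using i(1) by (intro nu_eqI) force+
  moreover have "unique_max l (Suc k) x"
    unfolding unique_max_def using * i(1) by (intro exI[of _ i]) auto
  ultimately show ?case using nu step by simp
qed (use assms in simp)

text \<open>The lattice points \<open>axis 1 1\<close> and \<open>axis 2 1\<close> are never cut off, so all the polygons contain the
  diamond that they span.\<close>

lemma abs_component_g_le: "l k * \<bar>g k $ 1\<bar> \<le> 1" "l k * \<bar>g k $ 2\<bar> \<le> 1"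
proof -
  have "l k * \<bar>g k $ c\<bar> \<le> 1" if c: "c = 1 \<or> c = 2" for c :: 2
  proof -
    define e :: "real^2" where "e = axis c 1"
    have w: "wt l i e = l i * \<bar>g i $ c\<bar>" for i
      by (simp add: wt_def e_def inner_axis)
    have w01: "wt l 0 e = (if c = 1 then 1 else 0)" "wt l 1 e = (if c = 2 then 1 else 0)"
      using c g_0 g_1 l_0 l_1 by (auto simp: w axis_def)
    \<comment> \<open>On the initial square the axis vector lies inside a side and has norm 1, which
      is within the range \<open>M 2\<close>.\<close>
    have "\<exists>i<2. wt l i e = 1 \<and> (\<forall>j<2. j \<noteq> i \<longrightarrow> wt l j e = 0)"
      using c w01 by (auto simp: less_2_cases_iff)
    then obtain i where i: "i < 2" "wt l i e = 1" "\<And>j. j < 2 \<Longrightarrow> j \<noteq> i \<Longrightarrow> wt l j e = 0"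
      by blast
    then have um: "unique_max l 2 e"
      unfolding unique_max_def by (intro exI[of _ i]) auto
    have "nu l 2 e = wt l i e"
      using i by (intro nu_eqI) (auto, metis order_refl zero_le_one)
    then have nu: "nu l 2 e = 1" using i(2) by simp
    have "e \<in> lattice" by (auto simp: lattice_def e_def axis_def)
    then have "nu l (k + 2) e = 1"
      using lattice_stable[of 2 "k + 2" e] um nu M_pos[of 2] by simp
    then show ?thesis
      using wt_le_nu[of k "k + 2" l e] by (simp add: w)
  qed
  then show "l k * \<bar>g k $ 1\<bar> \<le> 1" "l k * \<bar>g k $ 2\<bar> \<le> 1" by blast+
qed

text \<open>This bound, uniform in \<open>k\<close>, keeps the supremum defining the limit norm
  finite.\<close>

lemma wt_le: "wt l k x \<le> \<bar>x$1\<bar> + \<bar>x$2\<bar>"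
proof -
  have "wt l k x \<le> l k * (\<bar>g k $ 1\<bar> * \<bar>x$1\<bar> + \<bar>g k $ 2\<bar> * \<bar>x$2\<bar>)"
    unfolding wt_def inner_real2 using l_pos[of k]
    by (intro mult_left_mono order_trans[OF abs_triangle_ineq]) (simp_all add: abs_mult)
  also have "\<dots> = (l k * \<bar>g k $ 1\<bar>) * \<bar>x$1\<bar> + (l k * \<bar>g k $ 2\<bar>) * \<bar>x$2\<bar>"
    by (simp add: algebra_simps)
  also have "\<dots> \<le> 1 * \<bar>x$1\<bar> + 1 * \<bar>x$2\<bar>"
    by (intro add_mono mult_right_mono abs_component_g_le) simp_all
  finally show ?thesis by simp
qed

definition limit_norm :: "real^2 \<Rightarrow> real" where
  "limit_norm x = (SUP k. wt l k x)"

lemma wt_le_limit_norm: "wt l k x \<le> limit_norm x"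
  unfolding limit_norm_def using wt_le by (intro cSUP_upper bdd_aboveI2) auto

lemma limit_norm_leI: "(\<And>k. wt l k x \<le> c) \<Longrightarrow> limit_norm x \<le> c"
  unfolding limit_norm_def by (intro cSUP_least) auto

lemma limit_norm_le: "limit_norm x \<le> \<bar>x$1\<bar> + \<bar>x$2\<bar>"
  by (intro limit_norm_leI wt_le)

lemma abs_component_le_limit_norm: "\<bar>x$1\<bar> \<le> limit_norm x" "\<bar>x$2\<bar> \<le> limit_norm x"
  using wt_le_limit_norm[of 0 x] wt_le_limit_norm[of 1 x] g_0 g_1 l_0 l_1
  by (simp_all add: wt_def inner_axis')

lemma nu_le_limit_norm: "k > 0 \<Longrightarrow> nu l k x \<le> limit_norm x"
  by (simp add: nu_le_iff wt_le_limit_norm)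

lemma is_norm_limit_norm: "is_norm limit_norm"
  unfolding is_norm_def
proof (intro conjI allI)
  fix x y :: "real^2" and c :: real
  show ge0: "0 \<le> limit_norm x"
    using abs_component_le_limit_norm(1)[of x] by linarith
  show "limit_norm x = 0 \<longleftrightarrow> x = 0"
    using abs_component_le_limit_norm[of x] limit_norm_le[of x] ge0 by (auto simp: eq_real2_iff)
  show "limit_norm (x + y) \<le> limit_norm x + limit_norm y"
  proof (rule limit_norm_leI)
    fix k
    have "wt l k (x + y) \<le> wt l k x + wt l k y"
      unfolding wt_def inner_add_right using l_pos[of k]
      by (simp flip: distrib_left)
    then show "wt l k (x + y) \<le> limit_norm x + limit_norm y"
      using wt_le_limit_norm[of k x] wt_le_limit_norm[of k y] by linarith
  qed
  have le: "limit_norm (c *\<^sub>R x) \<le> \<bar>c\<bar> * limit_norm x" for c x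
    by (intro limit_norm_leI) (simp add: wt_scaleR mult_left_mono wt_le_limit_norm)
  show "limit_norm (c *\<^sub>R x) = \<bar>c\<bar> * limit_norm x"
  proof (cases "c = 0")
    case True
    then show ?thesis using le[of 0 x] abs_component_le_limit_norm(1)[of 0] by simp
  next
    case False
    then have "\<bar>c\<bar> * limit_norm x \<le> limit_norm (c *\<^sub>R x)"
      using le[of "inverse c" "c *\<^sub>R x"] by (simp add: field_simps)
    with le[of c x] show ?thesis by simp
  qed
qed

text \<open>The face in direction \<open>g k\<close> contains \<open>A k\<close> and
  \<open>B k\<close>, and multiples of such directions approximate every vector.\<close>

lemma perfect_Ext_limit_norm: "perfect_in (norm_topology limit_norm) (Ext (unit_ball limit_norm))"
proof (rule perfect_Ext_unit_ball[OF is_norm_limit_norm])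
  fix w :: "real^2" and \<delta> :: real
  assume "\<delta> > 0"
  then obtain k s where k: "k \<ge> 2" "norm (s *\<^sub>R g k - w) < \<delta>"
    using g_dense by blast
  have le1: "wt l i (A k) \<le> 1" "wt l i (B k) \<le> 1" for i
    using AB_old[of i k] AB_new[of k] k(1) by (cases "i = k"; force simp: wt_def abs_mult_pos)+
  \<comment> \<open>The approximating multiple of \<open>g k\<close> may be negative; the face on
    the opposite side is then used.\<close>
  define \<sigma> :: real where "\<sigma> = (if s \<ge> 0 then 1 else -1)"
  have \<sigma>: "\<bar>\<sigma>\<bar> = 1" "s * \<sigma> = \<bar>s\<bar>" by (auto simp: \<sigma>_def)
  have "limit_norm (\<sigma> *\<^sub>R A k) \<le> 1" "limit_norm (\<sigma> *\<^sub>R B k) \<le> 1"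
    using le1 \<sigma>(1) by (auto intro!: limit_norm_leI simp: wt_scaleR)
  moreover have "\<sigma> *\<^sub>R A k \<noteq> \<sigma> *\<^sub>R B k"
    using AB_neq[OF k(1)] \<sigma>(1) by auto
  moreover have "(s *\<^sub>R g k) \<bullet> x \<le> (s *\<^sub>R g k) \<bullet> (\<sigma> *\<^sub>R y)"
    if "limit_norm x \<le> 1" "l k * (g k \<bullet> y) = 1" for x y
  proof -
    have "l k * \<bar>g k \<bullet> x\<bar> \<le> l k * (g k \<bullet> y)"
      using wt_le_limit_norm[of k x] that by (simp add: wt_def)
    then have "\<bar>g k \<bullet> x\<bar> \<le> g k \<bullet> y" using l_pos[of k] by simp
    then have "\<bar>s\<bar> * \<bar>g k \<bullet> x\<bar> \<le> \<bar>s\<bar> * (g k \<bullet> y)"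
      by (intro mult_left_mono) simp_all
    moreover have "s * (g k \<bullet> x) \<le> \<bar>s\<bar> * \<bar>g k \<bullet> x\<bar>"
      by (metis abs_ge_self abs_mult)
    ultimately have "s * (g k \<bullet> x) \<le> (s * \<sigma>) * (g k \<bullet> y)"
      unfolding \<sigma>(2) by linarith
    then show ?thesis by (simp add: mult.assoc mult.left_commute)
  qed
  ultimately show "\<exists>w'. norm (w' - w) < \<delta> \<and> (\<exists>a b. a \<noteq> b \<and> limit_norm a \<le> 1 \<and> limit_norm b \<le> 1 \<and>
      (\<forall>x. limit_norm x \<le> 1 \<longrightarrow> w' \<bullet> x \<le> w' \<bullet> a \<and> w' \<bullet> x \<le> w' \<bullet> b))"
    using k AB_new[OF k(1)] by blast
qed

lemma limit_norm_unique_max: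
  assumes "K \<ge> 2" "x \<in> lattice" "unique_max l K x" "nu l K x \<le> real (M K)"
  shows "limit_norm x = nu l K x"
proof (rule antisym)
  show "nu l K x \<le> limit_norm x" using nu_le_limit_norm assms(1) by simp
  show "limit_norm x \<le> nu l K x"
  proof (rule limit_norm_leI)
    fix k
    have "wt l k x \<le> nu l (max K (Suc k)) x"
      by (intro wt_le_nu) simp
    then show "wt l k x \<le> nu l K x"
      using lattice_stable[of K "max K (Suc k)" x] assms by simp
  qed
qed

subsection \<open>Counting distances\<close>

text \<open>On a line through the origin one coordinate parametrises the points, so the norm is the
  absolute value of that integer times a constant. The vector \<open>d\<close> itself need not be a
  lattice point.\<close>

lemma line_distances:
  assumes "w \<noteq> 0"
  obtains c where
    "limit_norm ` {x\<in>lattice. w \<bullet> x = 0 \<and> limit_norm x \<le> real N} \<subseteq> (\<lambda>m. real m * c) ` {..N}"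
proof -
  have *: "limit_norm x \<in> (\<lambda>m. real m * limit_norm d) ` {..N}"
    if "x \<in> lattice" "limit_norm x \<le> real N" "x = x$i *\<^sub>R d" for x d and i :: 2
  proof -
    obtain z where z: "x$i = of_int z"
      using \<open>x \<in> lattice\<close> by (auto simp: lattice_def elim: Ints_cases)
    have "\<bar>x$i\<bar> \<le> real N"
      using abs_component_le_limit_norm[of x] that(2) exhaust_2[of i] by auto
    then have "nat \<bar>z\<bar> \<le> N" using z by linarith
    moreover have "limit_norm x = \<bar>x$i\<bar> * limit_norm d"
      using that(3) is_normD(3)[OF is_norm_limit_norm] by metis
    then have "limit_norm x = real (nat \<bar>z\<bar>) * limit_norm d"
      using z by simp
    ultimately show ?thesis by blast
  qed
  show ?thesis
  proof (cases "w$2 = 0")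
    case True
    then have "w$1 \<noteq> 0" using assms by (auto simp: eq_real2_iff)
    then have "x = x$2 *\<^sub>R axis 2 1" if "w \<bullet> x = 0" for x
      using that True by (simp add: inner_real2 eq_real2_iff axis_def)
    then show ?thesis
      using that[of "limit_norm (axis 2 1)"] * by blast
  next
    case False
    define d :: "real^2" where "d = (\<chi> i. if i = 1 then 1 else - (w$1 / w$2))"
    have "x = x$1 *\<^sub>R d" if "w \<bullet> x = 0" for x
      using that False by (simp add: inner_real2 eq_real2_iff d_def field_simps)
    then show ?thesis
      using that[of "limit_norm d"] * by blast
  qed
qed

text \<open>The integer \<open>g i \<bullet> x\<close> makes the value a multiple of
  \<open>l i\<close>, and \<open>l_lower\<close> gives \<open>1 / l i \<le> height i\<close>, which
  bounds the multiplier independently of the cut.\<close>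

lemma unique_max_distances:
  assumes "x \<in> lattice" "wt l i x \<le> real N"
  shows "wt l i x \<in> (\<lambda>m. real m * l i) ` {..N * height i}"
proof -
  have "g i \<bullet> x \<in> \<int>"
    using assms(1) g_Ints by (simp add: inner_real2 lattice_def)
  then obtain z where z: "g i \<bullet> x = of_int z" by (auto elim: Ints_cases)
  have h: "\<bar>g i $ 1\<bar> + \<bar>g i $ 2\<bar> \<le> real (height i)"
    unfolding height_def by linarith
  have "1 \<le> l i * real (height i)"
    using order_trans[OF l_lower mult_left_mono[OF h]] l_pos[of i] by simp
  then have "\<bar>of_int z\<bar> * 1 \<le> \<bar>of_int z\<bar> * (l i * real (height i))"
    by (intro mult_left_mono) simp_all
  also have "\<dots> = wt l i x * real (height i)"
    by (simp add: wt_def z)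
  also have "\<dots> \<le> real N * real (height i)"
    using assms(2) by (intro mult_right_mono) simp_all
  finally have "real_of_int \<bar>z\<bar> \<le> real_of_int (int (N * height i))" by simp
  then have "nat \<bar>z\<bar> \<le> N * height i" by linarith
  moreover have "wt l i x = real (nat \<bar>z\<bar>) * l i"
    by (simp add: wt_def z)
  ultimately show ?thesis by blast
qed

text \<open>Failure of uniqueness is a tie between two absolute values; \<open>s\<close> is the
  relative sign, and each sign gives one linear equation.\<close>

lemma not_unique_max_line:
  assumes "K > 0" "\<not> unique_max l K x"
  shows "\<exists>i<K. \<exists>j<K. \<exists>s\<in>{1, -1}. i \<noteq> j \<and> (l i *\<^sub>R g i + (s * l j) *\<^sub>R g j) \<bullet> x = 0"
proof -
  obtain i where i: "i < K" "nu l K x = wt l i x"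
    using nu_attained[OF assms(1)] .
  then obtain j where j: "j < K" "j \<noteq> i" "\<not> wt l j x < wt l i x"
    using assms(2) by (auto simp: unique_max_def)
  then have "\<bar>l i * (g i \<bullet> x)\<bar> = \<bar>l j * (g j \<bullet> x)\<bar>"
    using wt_le_nu[OF j(1), of l x] i(2) l_pos[of i] l_pos[of j] by (simp add: wt_def abs_mult)
  then have "l i * (g i \<bullet> x) + 1 * l j * (g j \<bullet> x) = 0 \<or> l i * (g i \<bullet> x) + (-1) * l j * (g j \<bullet> x) = 0"
    by (auto simp: abs_eq_iff)
  then show ?thesis
    using i(1) j by (fastforce simp: inner_add_left)
qed

lemma line_normal_nonzero:
  assumes "i \<noteq> j" "s \<in> {1, -1}"
  shows "l i *\<^sub>R g i + (s * l j) *\<^sub>R g j \<noteq> 0"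
proof
  assume "l i *\<^sub>R g i + (s * l j) *\<^sub>R g j = 0"
  then have "(l i *\<^sub>R g i + (s * l j) *\<^sub>R g j) \<bullet> perp (g j) = 0" by simp
  moreover have "g j \<bullet> perp (g j) = 0" by (simp add: inner_perp)
  ultimately have "l i * (g i \<bullet> perp (g j)) = 0"
    by (simp add: inner_add_left)
  then show False
    using l_pos[of i] g_indep[OF assms(1)] by (simp add: inner_perp)
qed

text \<open>Since \<open>N \<le> M K\<close>, a lattice point of norm at most \<open>N\<close>
  either has its norm decided by one of the first \<open>K\<close> sides or lies on a line of ties.
  Both cases yield arithmetic progressions, whose lengths are added up.\<close>

lemma card_distances:
  assumes K: "K \<ge> 2" and N: "N > 0" "N \<le> M K"
  shows "finite (dist_set limit_norm N lattice)"
    and "card (dist_set limit_norm N lattice) \<le> N * count_bound K"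
proof -
  define I where "I = {(i, j, s). i < K \<and> j < K \<and> i \<noteq> j \<and> s \<in> {1, - 1 :: real}}"
  have I_sub: "I \<subseteq> {..<K} \<times> {..<K} \<times> {1, -1}" by (auto simp: I_def)
  have finI: "finite I" by (rule finite_subset[OF I_sub]) simp
  have cardI: "card I \<le> 2 * K * K"
    using card_mono[OF _ I_sub] by (simp add: card_cartesian_product algebra_simps)
  define W where "W = (\<lambda>(i, j, s). l i *\<^sub>R g i + (s * l j) *\<^sub>R g j)"
  have W: "W p \<noteq> 0" if "p \<in> I" for p
    using that line_normal_nonzero by (auto simp: I_def W_def)
  have "\<forall>p\<in>I. \<exists>c. limit_norm ` {x\<in>lattice. W p \<bullet> x = 0 \<and> limit_norm x \<le> real N}
      \<subseteq> (\<lambda>m. real m * c) ` {..N}"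
  proof
    fix p assume "p \<in> I"
    show "\<exists>c. limit_norm ` {x\<in>lattice. W p \<bullet> x = 0 \<and> limit_norm x \<le> real N}
        \<subseteq> (\<lambda>m. real m * c) ` {..N}"
      by (rule line_distances[OF W[OF \<open>p \<in> I\<close>]]) blast
  qed
  from bchoice[OF this] obtain c where c: "\<And>p. p \<in> I \<Longrightarrow>
      limit_norm ` {x\<in>lattice. W p \<bullet> x = 0 \<and> limit_norm x \<le> real N} \<subseteq> (\<lambda>m. real m * c p) ` {..N}"
    by blast
  define U where "U = (\<Union>i<K. (\<lambda>m. real m * l i) ` {..N * height i}) \<union> (\<Union>p\<in>I. (\<lambda>m. real m * c p) ` {..N})"
  have finU: "finite U" using finI by (simp add: U_def)
  have sub: "dist_set limit_norm N lattice \<subseteq> U"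
  proof
    fix r assume "r \<in> dist_set limit_norm N lattice"
    then obtain y z where yz: "y \<in> lattice" "z \<in> lattice" "r = limit_norm (y - z)" "limit_norm (y - z) \<le> real N"
      by (auto simp: dist_set_def)
    define x where "x = y - z"
    have x: "x \<in> lattice" "r = limit_norm x" "limit_norm x \<le> real N"
      using yz by (simp_all add: x_def lattice_def)
    show "r \<in> U"
    proof (cases "unique_max l K x")
      case True
      have "nu l K x \<le> real N"
        using nu_le_limit_norm[of K x] K x(3) by simp
      then have "r = nu l K x"
        using limit_norm_unique_max[OF K x(1) True] x(2) N(2) by simp
      then obtain i where i: "i < K" "r = wt l i x"
        using nu_attained[of K l x] K by auto
      then show ?thesis
        using unique_max_distances[OF x(1), of i N] x by (auto simp: U_def)
    next
      case False
      then obtain i j s where p: "(i, j, s) \<in> I" "W (i, j, s) \<bullet> x = 0"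
        using not_unique_max_line[of K x] K by (fastforce simp: I_def W_def)
      then have "r \<in> (\<lambda>m. real m * c (i, j, s)) ` {..N}"
        using c[OF p(1)] x by blast
      then show ?thesis using p(1) by (auto simp: U_def)
    qed
  qed
  then show "finite (dist_set limit_norm N lattice)"
    using finU finite_subset by blast
  have "card (dist_set limit_norm N lattice) \<le> card U"
    by (rule card_mono[OF finU sub])
  also have "\<dots> \<le> card (\<Union>i<K. (\<lambda>m. real m * l i) ` {..N * height i}) + card (\<Union>p\<in>I. (\<lambda>m. real m * c p) ` {..N})"
    unfolding U_def by (rule card_Un_le)
  also have "\<dots> \<le> (\<Sum>i<K. card ((\<lambda>m. real m * l i) ` {..N * height i})) + (\<Sum>p\<in>I. card ((\<lambda>m. real m * c p) ` {..N}))"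
    by (intro add_mono card_UN_le finI) simp
  also have "\<dots> \<le> (\<Sum>i<K. N * height i + 1) + (\<Sum>p\<in>I. N + 1)"
    by (intro add_mono sum_mono order_trans[OF card_image_le]) simp_all
  \<comment> \<open>The extra 1 in each length counts the distance 0 and is absorbed because
    \<open>N \<ge> 1\<close>.\<close>
  also have "\<dots> \<le> (\<Sum>i<K. N * (height i + 1)) + (\<Sum>p\<in>I. 2 * N)"
    using N(1) by (intro add_mono sum_mono) (auto simp: algebra_simps)
  also have "\<dots> \<le> N * (\<Sum>i<K. height i + 1) + 2 * N * (2 * K * K)"
    using mult_le_mono2[OF cardI, of "2 * N"] by (simp add: sum_distrib_left algebra_simps)
  also have "\<dots> = N * count_bound K"
    by (simp add: count_bound_def algebra_simps)
  finally show "card (dist_set limit_norm N lattice) \<le> N * count_bound K" .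
qed

lemma well_distributed_lattice: "well_distributed limit_norm lattice"
  unfolding well_distributed_def
proof (intro exI allI)
  fix x :: "real^2"
  define y :: "real^2" where "y = (\<chi> i. of_int \<lfloor>x$i\<rfloor>)"
  have "y \<in> lattice" by (simp add: y_def lattice_def)
  moreover have "\<bar>(x - y)$i\<bar> \<le> 1" for i
    by (simp add: y_def) linarith
  from this[of 1] this[of 2] have "limit_norm (x - y) \<le> 2"
    using limit_norm_le[of "x - y"] by linarith
  ultimately show "\<exists>y\<in>lattice. limit_norm (x - y) \<le> 2" by blast
qed

end

section \<open>Choice of the thresholds and conclusion\<close>

theorem theorem2:
  fixes \<psi> :: "real \<Rightarrow> real"
  assumes "\<And>u. u > 0 \<Longrightarrow> \<psi> u > 0"
    and "filterlim \<psi> at_top at_top"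
  shows "\<exists>\<nu> S. is_norm \<nu> \<and> well_distributed \<nu> S \<and>
           (\<forall>N>0. finite (dist_set \<nu> N S)) \<and>
           (\<lambda>N. real (card (dist_set \<nu> N S))) \<in> o(\<lambda>N. real N * \<psi> (real N)) \<and>
           perfect_in (norm_topology \<nu>) (Ext (unit_ball \<nu>)) \<and>
           uncountable (Ext (unit_ball \<nu>))"
proof -
  obtain g where "directions g"
    using directions_exist by blast
  then interpret directions g .
  \<comment> \<open>Past its threshold, \<open>\<psi>\<close> dominates the constant of the next
    stage with a spare factor \<open>K + 1\<close>; this growing factor is what gives
    little-o.\<close>
  have "\<exists>m::nat. \<forall>u\<ge>real m. real (K + 1) * real (count_bound (K + 1)) \<le> \<psi> u" for K
  proof -
    have "\<forall>\<^sub>F u in at_top. real (K + 1) * real (count_bound (K + 1)) \<le> \<psi> u"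
      using assms(2) unfolding filterlim_at_top by blast
    then obtain b where b: "\<And>u. u \<ge> b \<Longrightarrow> real (K + 1) * real (count_bound (K + 1)) \<le> \<psi> u"
      by (auto simp: eventually_at_top_linorder)
    obtain m where "b \<le> real m"
      using real_arch_simple by blast
    then show ?thesis using b by (meson order_trans)
  qed
  then obtain m where m: "\<And>K u. u \<ge> real (m K) \<Longrightarrow> real (K + 1) * real (count_bound (K + 1)) \<le> \<psi> u"
    by metis
  \<comment> \<open>Summing the thresholds gives monotonicity; the term \<open>K + 1\<close> gives
    positivity and unboundedness.\<close>
  define M where "M K = K + 1 + (\<Sum>i\<le>K. m i)" for K
  have M_mono: "mono M"
    by (rule incseq_SucI) (simp add: M_def)
  have M_ge: "M K \<ge> 1" "M K \<ge> K" "M K \<ge> m K" for K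
    using member_le_sum[of K "{..K}" m] by (auto simp: M_def)
  obtain l A B where "corner_cutting g M l A B"
    using corner_cutting_exists[OF M_mono M_ge(1)] by blast
  then interpret corner_cutting g M l A B .
  have fin: "finite (dist_set limit_norm N lattice)" if "N > 0" for N
    using card_distances(1)[of "max 2 N" N] M_ge(2)[of "max 2 N"] that by simp
  have small: "(\<lambda>N. real (card (dist_set limit_norm N lattice))) \<in> o(\<lambda>N. real N * \<psi> (real N))"
  proof (rule landau_o.smallI)
    fix c :: real assume c: "c > 0"
    obtain K0 where "1 / c \<le> real K0"
      using real_arch_simple by blast
    then have K0: "1 \<le> c * real K0"
      using c by (simp add: field_simps)
    show "\<forall>\<^sub>F N in sequentially. norm (real (card (dist_set limit_norm N lattice)))
        \<le> c * norm (real N * \<psi> (real N))"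
    proof (rule eventually_mono[OF eventually_gt_at_top[of "M (K0 + 2)"]])
      fix N assume N: "M (K0 + 2) < N"
      \<comment> \<open>The first stage whose range reaches \<open>N\<close>. By minimality
        \<open>N\<close> exceeds \<open>M (K - 1)\<close>, hence the threshold
        \<open>m (K - 1)\<close>, which is the one for \<open>count_bound K\<close>.\<close>
      define K where "K = (LEAST K. N \<le> M K)"
      have NK: "N \<le> M K"
        unfolding K_def by (rule LeastI[of _ N]) (rule M_ge(2))
      have K: "K > K0 + 2"
      proof (rule ccontr)
        assume "\<not> K > K0 + 2"
        then have "M K \<le> M (K0 + 2)" using M_mono by (simp add: monoD)
        then show False using NK N by simp
      qed
      have "\<not> N \<le> M (K - 1)"
        using not_less_Least[of "K - 1" "\<lambda>K. N \<le> M K"] K unfolding K_def by simp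
      then have "real (m (K - 1)) \<le> real N"
        using M_ge(3)[of "K - 1"] by simp
      then have \<psi>: "real K * real (count_bound K) \<le> \<psi> (real N)"
        using m[of "K - 1" "real N"] K by simp
      have "c * real K0 \<le> c * real K"
        using c K by simp
      then have "1 * real (count_bound K) \<le> (c * real K) * real (count_bound K)"
        using K0 by (intro mult_right_mono) simp_all
      also have "\<dots> \<le> c * \<psi> (real N)"
        using \<psi> c by (simp add: mult.assoc)
      finally have cb: "real (count_bound K) \<le> c * \<psi> (real N)" by simp
      have N0: "N > 0" using N by simp
      have "real (card (dist_set limit_norm N lattice)) \<le> real (N * count_bound K)"
        by (rule of_nat_mono, rule card_distances(2)) (use K N0 NK in auto)
      also have "\<dots> \<le> real N * (c * \<psi> (real N))"
        using mult_left_mono[OF cb, of "real N"] by simp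
      finally show "norm (real (card (dist_set limit_norm N lattice))) \<le> c * norm (real N * \<psi> (real N))"
        using assms(1)[of "real N"] N0 by (simp add: abs_mult mult_ac)
    qed
  qed
  have "uncountable (Ext (unit_ball limit_norm))"
    using uncountable_perfect perfect_Ext_limit_norm norm_topology_euclidean[OF is_norm_limit_norm] by metis
  then show ?thesis
    using is_norm_limit_norm well_distributed_lattice fin small perfect_Ext_limit_norm by blast
qed

end
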